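(* Let $G=(V,E,w,\mu)$ be a weighted graph as in the context with $D_\mu<\infty$. Let $q>1$, and let $\psi:V\to[0,\infty)$ be bounded, not identically zero, with $\inf_{x\in V}\psi(x)>0$. For $\lambda>0$ let $u$ be a positive solution of $$u_t-\Delta u=u\,|\log u|^q\ \text{ in } V\times(0,T),\qquad u(x,0)=\lambda\psi(x)\ \text{ for } x\in V,$$ and let $T_\lambda$ be its lifespan. Let $\Omega\subset V$ be a nonempty finite connected set, let $\phi>0$ be the normalized first Dirichlet eigenfunction on $\Omega$, and assume $$\eta(0):=\int_\Omega u(\cdot,0)\,\phi\,d\mu=\sum_{x\in\Omega}\mu(x)\,\lambda\psi(x)\phi(x)\ \ge 1 .$$ Then there exists a constant $C=C(q,V)>0$ (depending only on $q$ and the weighted graph) such that $T_\lambda<\infty$ whenever $\lambda>\Lambda$, where $\Lambda>0$ satisfies $$\Lambda\cdot\inf_{x\in V}\psi(x)\ \ge\ \max\{C(q,V),\,e^{1-q}\}.$$ Furthermore, $$\lim_{\lambda\to+\infty}\big(\log(\lambda\|\psi\|_\infty)\big)^{q-1}T_\lambda=\frac1{q-1}.$$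
   Context: Graph setting: $G=(V,E,w,\mu)$ is an infinite, locally finite, connected graph without loops or multiple edges, with edge weights $w_{xy}=w_{yx}>0$ for $xy\in E$ and vertex measure $\mu:V\to(0,\infty)$. Write $y\sim x$ if $xy\in E$. The Laplacian is $\Delta u(x)=\frac1{\mu(x)}\sum_{y\sim x}w_{xy}(u(y)-u(x))$, and $D_\mu:=\sup_{x\in V}\frac{1}{\mu(x)}\sum_{y\sim x}w_{xy}$. For $A\subset V$, $\int_A f\,d\mu=\sum_{x\in A}\mu(x)f(x)$. $\|\psi\|_\infty=\sup_{x\in V}|\psi(x)|$. Solutions: a (positive) solution on $[0,T)$ is a function $u$ on $V\times[0,T)$, positive on $V\times(0,T)$, such that for each $x\in V$, $u(x,\cdot)$ is continuous on $[0,T)$ and $C^1$ on $(0,T)$, the equation and initial condition hold, and $u\in L^\infty(V\times[0,T'])$ for every $0<T'<T$. The lifespan is $T_\lambda:=\sup\{T>0:\text{ the problem with initial datum }\lambda\psi\text{ admits a solution on }[0,T)\}$. Dirichlet eigenfunction: for finite $\Omega\subset V$, $\Delta_\Omega$ acts on functions $f$ on $\Omega$ by extending $f$ by zero to $V$, applying $\Delta$, and restricting to $\Omega$. For $\Omega$ nonempty, finite and connected, the smallest eigenvalue $\lambda_1(\Omega)>0$ of $-\Delta_\Omega$ is simple and has an eigenfunction $\phi>0$ on $\Omega$, normalized by $\sum_{x\in\Omega}\mu(x)\phi(x)=1$. *)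

theory Defs
  imports "HOL-Analysis.Analysis"
begin

(* The vertex set is the whole type 'v; xy is an edge iff adj x y.  The weight function w is
   only meaningful on edges: every sum below ranges over neighbours. *)
locale weighted_graph =
  fixes adj :: "'v \<Rightarrow> 'v \<Rightarrow> bool"
    and w :: "'v \<Rightarrow> 'v \<Rightarrow> real"
    and \<mu> :: "'v \<Rightarrow> real"
  assumes infinite_vertices: "infinite (UNIV :: 'v set)"
    and adj_sym: "adj x y \<Longrightarrow> adj y x"
    and no_loops: "\<not> adj x x"
    and locally_finite: "finite {y. adj x y}"
    and connected_graph: "adj\<^sup>*\<^sup>* x y"
    and weight_sym: "adj x y \<Longrightarrow> w x y = w y x"
    and weight_pos: "adj x y \<Longrightarrow> 0 < w x y"
    and measure_pos: "0 < \<mu> x"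

definition connected_subset :: "('v \<Rightarrow> 'v \<Rightarrow> bool) \<Rightarrow> 'v set \<Rightarrow> bool" where
  "connected_subset adj \<Omega> \<longleftrightarrow>
     (\<forall>x\<in>\<Omega>. \<forall>y\<in>\<Omega>. (\<lambda>a b. a \<in> \<Omega> \<and> b \<in> \<Omega> \<and> adj a b)\<^sup>*\<^sup>* x y)"

definition laplacian ::
  "('v \<Rightarrow> 'v \<Rightarrow> bool) \<Rightarrow> ('v \<Rightarrow> 'v \<Rightarrow> real) \<Rightarrow> ('v \<Rightarrow> real) \<Rightarrow> ('v \<Rightarrow> real) \<Rightarrow> 'v \<Rightarrow> real" where
  "laplacian adj w \<mu> f x = 1 / \<mu> x * (\<Sum>y | adj x y. w x y * (f y - f x))"

definition D_mu ::
  "('v \<Rightarrow> 'v \<Rightarrow> bool) \<Rightarrow> ('v \<Rightarrow> 'v \<Rightarrow> real) \<Rightarrow> ('v \<Rightarrow> real) \<Rightarrow> ereal" where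
  "D_mu adj w \<mu> = (SUP x. ereal (1 / \<mu> x * (\<Sum>y | adj x y. w x y)))"

definition sup_norm :: "('v \<Rightarrow> real) \<Rightarrow> real" where
  "sup_norm \<psi> = (SUP x. \<bar>\<psi> x\<bar>)"

(* Functions on Omega are represented by functions on 'v of which only the values on Omega
   matter, as input and as output. *)
definition dirichlet_laplacian ::
  "('v \<Rightarrow> 'v \<Rightarrow> bool) \<Rightarrow> ('v \<Rightarrow> 'v \<Rightarrow> real) \<Rightarrow> ('v \<Rightarrow> real) \<Rightarrow> 'v set \<Rightarrow> ('v \<Rightarrow> real) \<Rightarrow> 'v \<Rightarrow> real" where
  "dirichlet_laplacian adj w \<mu> \<Omega> f = laplacian adj w \<mu> (\<lambda>y. if y \<in> \<Omega> then f y else 0)"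

definition dirichlet_eigenvalue ::
  "('v \<Rightarrow> 'v \<Rightarrow> bool) \<Rightarrow> ('v \<Rightarrow> 'v \<Rightarrow> real) \<Rightarrow> ('v \<Rightarrow> real) \<Rightarrow> 'v set \<Rightarrow> real \<Rightarrow> bool" where
  "dirichlet_eigenvalue adj w \<mu> \<Omega> l \<longleftrightarrow>
     (\<exists>f. (\<exists>x\<in>\<Omega>. f x \<noteq> 0) \<and> (\<forall>x\<in>\<Omega>. - dirichlet_laplacian adj w \<mu> \<Omega> f x = l * f x))"

definition first_dirichlet_eigenvalue ::
  "('v \<Rightarrow> 'v \<Rightarrow> bool) \<Rightarrow> ('v \<Rightarrow> 'v \<Rightarrow> real) \<Rightarrow> ('v \<Rightarrow> real) \<Rightarrow> 'v set \<Rightarrow> real" where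
  "first_dirichlet_eigenvalue adj w \<mu> \<Omega> = (LEAST l. dirichlet_eigenvalue adj w \<mu> \<Omega> l)"

definition normalized_first_eigenfunction ::
  "('v \<Rightarrow> 'v \<Rightarrow> bool) \<Rightarrow> ('v \<Rightarrow> 'v \<Rightarrow> real) \<Rightarrow> ('v \<Rightarrow> real) \<Rightarrow> 'v set \<Rightarrow> ('v \<Rightarrow> real) \<Rightarrow> bool" where
  "normalized_first_eigenfunction adj w \<mu> \<Omega> \<phi> \<longleftrightarrow>
     (\<forall>x\<in>\<Omega>. 0 < \<phi> x) \<and>
     (\<forall>x\<in>\<Omega>. - dirichlet_laplacian adj w \<mu> \<Omega> \<phi> x
            = first_dirichlet_eigenvalue adj w \<mu> \<Omega> * \<phi> x) \<and>
     (\<Sum>x\<in>\<Omega>. \<mu> x * \<phi> x) = 1"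

(* Boundedness on V x [0,T'] is membership in L^infty there: V is discrete with full-support
   measure and u is continuous in time, so the essential supremum is the supremum. *)
definition positive_solution ::
  "('v \<Rightarrow> 'v \<Rightarrow> bool) \<Rightarrow> ('v \<Rightarrow> 'v \<Rightarrow> real) \<Rightarrow> ('v \<Rightarrow> real) \<Rightarrow> real \<Rightarrow> ('v \<Rightarrow> real) \<Rightarrow> real
     \<Rightarrow> ('v \<Rightarrow> real \<Rightarrow> real) \<Rightarrow> bool" where
  "positive_solution adj w \<mu> q u0 T u \<longleftrightarrow>
     (\<forall>x. \<forall>t\<in>{0<..<T}. 0 < u x t) \<and>
     (\<forall>x. continuous_on {0..<T} (u x)) \<and>
     (\<forall>x. u x C1_differentiable_on {0<..<T}) \<and>
     (\<forall>x. \<forall>t\<in>{0<..<T}.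
        deriv (u x) t - laplacian adj w \<mu> (\<lambda>y. u y t) x = u x t * \<bar>ln (u x t)\<bar> powr q) \<and>
     (\<forall>x. u x 0 = u0 x) \<and>
     (\<forall>T'. 0 < T' \<and> T' < T \<longrightarrow> bounded ((\<lambda>(x, t). u x t) ` (UNIV \<times> {0..T'})))"

definition lifespan ::
  "('v \<Rightarrow> 'v \<Rightarrow> bool) \<Rightarrow> ('v \<Rightarrow> 'v \<Rightarrow> real) \<Rightarrow> ('v \<Rightarrow> real) \<Rightarrow> real \<Rightarrow> ('v \<Rightarrow> real) \<Rightarrow> ereal" where
  "lifespan adj w \<mu> q u0 =
     Sup {ereal T | T. 0 < T \<and> (\<exists>u. positive_solution adj w \<mu> q u0 T u)}"

end

theory Submission
  imports Defs "HOL-Real_Asymp.Real_Asymp"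
begin

text \<open>
  Let \<open>y' = y (log y)\<^sup>q\<close>, \<open>y 0 = exp A > 1\<close>: \<open>y\<close> is explicit and blows up at time
  \<open>A\<^sup>1\<^sup>-\<^sup>q / (q - 1)\<close>. Constants are annihilated by the Laplacian, so \<open>y\<close> is itself a solution.
  If \<open>u 0 \<ge> exp A\<close>, comparison gives \<open>u \<ge> y\<close>, so \<open>u\<close> cannot outlive \<open>y\<close>; if
  \<open>1 < inf u 0 \<le> u 0 \<le> exp A\<close>, monotone iteration of the Duhamel operator between the
  subsolution \<open>inf u 0\<close> and the supersolution \<open>y\<close> yields a solution that lives at least as
  long as \<open>y\<close>. With \<open>m\<close> and \<open>M\<close> the infimum and supremum of \<open>\<psi>\<close>, the lifespan thus
  lies between \<open>log(\<lambda> M)\<^sup>1\<^sup>-\<^sup>q / (q - 1)\<close> and \<open>log(\<lambda> m)\<^sup>1\<^sup>-\<^sup>q / (q - 1)\<close>, and the quotient of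
  these bounds tends to 1. The upper bound is finite once \<open>\<lambda> m > 1\<close>, so \<open>C = 1\<close> works.
\<close>

section \<open>The reaction, the blow-up profile and their elementary estimates\<close>

definition reaction :: "real \<Rightarrow> real \<Rightarrow> real" where
  "reaction q s = s * \<bar>ln s\<bar> powr q"

text \<open>For \<open>v = ln y\<close> the equation \<open>y' = reaction q y\<close> with
  \<open>y > 1\<close> reads \<open>v' = v powr q\<close>, so \<open>v powr (1 - q)\<close>
  decreases with constant slope \<open>1 - q\<close> from its initial value
  \<open>A powr (1 - q)\<close>. The base reaches 0 at the blow-up time, and the formula is
  meaningful only before it.\<close>

definition profile :: "real \<Rightarrow> real \<Rightarrow> real \<Rightarrow> real" where
  "profile q A t = exp ((A powr (1 - q) - (q - 1) * t) powr (1 / (1 - q)))"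

lemma reaction_nonneg: "0 \<le> s \<Longrightarrow> 0 \<le> reaction q s"
  by (simp add: reaction_def)

lemma continuous_on_reaction:
  assumes "0 < q" "continuous_on S f" "\<And>s. s \<in> S \<Longrightarrow> 0 < f s"
  shows "continuous_on S (\<lambda>s. reaction q (f s))"
  unfolding reaction_def using assms
  by (intro continuous_intros continuous_on_powr') (force simp: less_imp_neq)+

text \<open>Both factors increase on \<open>[1, \<infinity>)\<close>. On \<open>[0, 1]\<close> the
  reaction vanishes at both ends and is positive between them, so monotone arguments have to stay
  above 1.\<close>

lemma reaction_mono:
  assumes "0 \<le> q" "1 \<le> r" "r \<le> s"
  shows "reaction q r \<le> reaction q s"
  unfolding reaction_def using assms by (intro mult_mono powr_mono2) auto

text \<open>The bound extends down to \<open>r = 0\<close>, where \<^term>\<open>reaction q\<close> is not Lipschitz,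
  because \<^term>\<open>reaction q 1 = 0\<close> and the reaction is nonnegative.\<close>

lemma reaction_diff_le:
  assumes q: "1 < q" and r: "0 \<le> r" and s: "1 \<le> s" "s \<le> K"
  shows "reaction q s - reaction q r \<le> (ln K powr q + q * ln K powr (q - 1)) * max 0 (s - r)"
proof -
  define L where "L = ln K powr q + q * ln K powr (q - 1)"
  have L: "0 \<le> L" using q by (simp add: L_def)
  \<comment> \<open>Replacing \<open>r\<close> by \<open>r'\<close> does not raise the reaction, and
    it moves the comparison to \<open>[1, \<infinity>)\<close>, where the mean value theorem
    applies. There \<open>L\<close>, the slope formula evaluated at \<open>K\<close>, bounds the
    slope up to \<open>K\<close> because \<open>q > 1\<close>.\<close>
  define r' where "r' = max 1 r"
  have rr: "reaction q r' \<le> reaction q r"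
    using reaction_nonneg[OF r, of q] by (auto simp: r'_def reaction_def max_def)
  show ?thesis
  proof (cases "r' < s")
    case True
    have "continuous_on {r'..s} (reaction q)"
      using q by (intro continuous_on_reaction[where f = "\<lambda>x. x"]) (auto simp: r'_def)
    moreover have der: "(reaction q has_real_derivative ln z powr q + q * ln z powr (q - 1)) (at z)"
      if "1 < z" for z
    proof -
      have "((\<lambda>z. z * ln z powr q) has_real_derivative ln z powr q + q * ln z powr (q - 1)) (at z)"
        using that by (auto intro!: derivative_eq_intros simp: field_simps powr_diff)
      moreover have "eventually (\<lambda>z. z * ln z powr q = reaction q z) (nhds z)"
        using eventually_nhds_in_open[of "{1<..}" z] that
        by (auto elim!: eventually_mono simp: reaction_def)
      ultimately show ?thesis
        using DERIV_cong_ev[of z z "\<lambda>z. z * ln z powr q" "reaction q"] by simp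
    qed
    ultimately obtain l z where z: "r' < z" "z < s" and l: "DERIV (reaction q) z :> l"
      and eq: "reaction q s - reaction q r' = (s - r') * l"
      using MVT[OF True, of "reaction q"] by (force simp: real_differentiable_def r'_def)
    have z1: "1 < z" using z by (simp add: r'_def)
    have "l = ln z powr q + q * ln z powr (q - 1)"
      using DERIV_unique[OF l der[OF z1]] .
    also have "\<dots> \<le> L"
      unfolding L_def using z1 z s q by (intro add_mono mult_left_mono powr_mono2) auto
    finally have "(s - r') * l \<le> (s - r') * L"
      using True by (intro mult_left_mono) auto
    also have "\<dots> \<le> max 0 (s - r) * L"
      using L by (intro mult_right_mono) (auto simp: r'_def)
    finally show ?thesis
      using rr eq by (simp add: L_def mult.commute)
  next
    case False
    then have "s \<le> r'" by simp
    then have "reaction q s \<le> reaction q r"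
      using reaction_mono[of q s r'] q s rr by simp
    moreover have "0 \<le> L * max 0 (s - r)" using L by simp
    ultimately show ?thesis by (simp add: L_def)
  qed
qed

lemma profile_0: "1 < q \<Longrightarrow> 0 < A \<Longrightarrow> profile q A 0 = exp A"
  by (simp add: profile_def powr_powr)

lemma profile_gt_1: "(q - 1) * t < A powr (1 - q) \<Longrightarrow> 1 < profile q A t"
  by (simp add: profile_def)

lemma profile_has_derivative:
  assumes q: "1 < q" and t: "(q - 1) * t < A powr (1 - q)"
  shows "(profile q A has_real_derivative reaction q (profile q A t)) (at t)"
proof -
  define R where "R = A powr (1 - q) - (q - 1) * t"
  have R: "0 < R" using t by (simp add: R_def)
  \<comment> \<open>The exponent of the profile solves \<open>v' = v powr q\<close>: the inner
    derivative cancels \<open>1 / (1 - q)\<close>, and \<open>1 / (1 - q) - 1 = q / (1 - q)\<close>.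
    The absolute value is there to match \<open>reaction\<close>.\<close>
  have *: "(1 / (1 - q)) * R powr (1 / (1 - q) - 1) * (- (q - 1)) = \<bar>R powr (1 / (1 - q))\<bar> powr q"
  proof -
    have "1 / (1 - q) - 1 = 1 / (1 - q) * q" using q by (simp add: field_simps)
    then have "\<bar>R powr (1 / (1 - q))\<bar> powr q = R powr (1 / (1 - q) - 1)"
      by (simp add: powr_powr)
    moreover have "(1 / (1 - q)) * (- (q - 1)) = 1" using q by (simp add: field_simps)
    ultimately show ?thesis by (metis mult.assoc mult.commute mult.left_neutral)
  qed
  have "((\<lambda>t. A powr (1 - q) - (q - 1) * t) has_real_derivative - (q - 1)) (at t)"
    by (auto intro!: derivative_eq_intros)
  then have "((\<lambda>t. (A powr (1 - q) - (q - 1) * t) powr (1 / (1 - q))) has_real_derivative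
      (1 / (1 - q)) * R powr (1 / (1 - q) - 1) * (- (q - 1))) (at t)"
    unfolding R_def
    by (intro DERIV_chain2[OF has_real_derivative_powr]) (use t in auto)
  then have "((\<lambda>t. (A powr (1 - q) - (q - 1) * t) powr (1 / (1 - q))) has_real_derivative
      \<bar>R powr (1 / (1 - q))\<bar> powr q) (at t)"
    by (simp only: *)
  then show ?thesis
    unfolding profile_def[abs_def] reaction_def ln_exp R_def
    by (rule DERIV_fun_exp)
qed

lemma profile_mono:
  assumes "1 < q" "s \<le> t" "(q - 1) * t < A powr (1 - q)"
  shows "profile q A s \<le> profile q A t"
proof -
  have "(q - 1) * s \<le> (q - 1) * t" using assms by simp
  then show ?thesis
    unfolding profile_def exp_le_cancel_iff using assms by (intro powr_mono2') auto
qed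

section \<open>Duhamel's formula and calculus on half-open time intervals\<close>

text \<open>Integrating factor: the integrand is the derivative of
  \<open>exp (k * s) * g s\<close>.\<close>

lemma duhamel:
  fixes g g' :: "real \<Rightarrow> real"
  assumes "0 \<le> t" "\<And>s. s \<in> {0..t} \<Longrightarrow> (g has_real_derivative g' s) (at s within {0..t})"
  shows "((\<lambda>s. exp (k * s) * (g' s + k * g s)) has_integral exp (k * t) * g t - g 0) {0..t}"
proof -
  have "((\<lambda>s. exp (k * s) * g s) has_vector_derivative exp (k * s) * (g' s + k * g s))
      (at s within {0..t})" if "s \<in> {0..t}" for s
    unfolding has_real_derivative_iff_has_vector_derivative[symmetric]
    using assms(2)[OF that] by (auto intro!: derivative_eq_intros simp: algebra_simps)
  from fundamental_theorem_of_calculus[OF assms(1) this] show ?thesis by simp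
qed

lemma at_within_Ico:
  fixes t :: real
  assumes "0 \<le> t" "t < b" "b \<le> T"
  shows "at t within {0..<T} = at t within {0..b}"
  using assms by (intro at_within_nhd[of _ "{..<b}"]) auto

lemma continuous_on_indefinite_integral_Ico:
  fixes f :: "real \<Rightarrow> real"
  assumes "\<And>b. 0 \<le> b \<Longrightarrow> b < T \<Longrightarrow> f integrable_on {0..b}"
  shows "continuous_on {0..<T} (\<lambda>t. integral {0..t} f)"
  unfolding continuous_on_eq_continuous_within
proof
  fix t assume t: "t \<in> {0..<T}"
  define b where "b = (t + T) / 2"
  have b: "t < b" "b < T" "0 \<le> t" using t by (auto simp: b_def)
  have "continuous_on {0..b} (\<lambda>t. integral {0..t} f)"
    using assms[of b] b by (intro indefinite_integral_continuous_1) auto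
  then show "continuous (at t within {0..<T}) (\<lambda>t. integral {0..t} f)"
    using b at_within_Ico[of t b T] by (auto simp: continuous_on_eq_continuous_within)
qed

lemma tendsto_power_over_fact:
  fixes x :: real
  shows "(\<lambda>n. x ^ n / fact n) \<longlonglongrightarrow> 0"
  using summable_LIMSEQ_zero[OF summable_exp[of x]] by (simp add: field_simps)

section \<open>The Duhamel operator of the graph and its order properties\<close>

context weighted_graph
begin

text \<open>The quantity whose supremum is \<open>D_mu\<close>; at each vertex it is the decay rate
  in the Duhamel operator.\<close>

definition vertex_degree :: "'v \<Rightarrow> real" where
  "vertex_degree x = 1 / \<mu> x * (\<Sum>y | adj x y. w x y)"

definition source :: "real \<Rightarrow> ('v \<Rightarrow> real \<Rightarrow> real) \<Rightarrow> 'v \<Rightarrow> real \<Rightarrow> real" where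
  "source q u x s = 1 / \<mu> x * (\<Sum>y | adj x y. w x y * u y s) + reaction q (u x s)"

text \<open>The diagonal part of the Laplacian goes into the exponential, which leaves an
  order-preserving operator.\<close>

definition mild :: "real \<Rightarrow> ('v \<Rightarrow> real) \<Rightarrow> ('v \<Rightarrow> real \<Rightarrow> real) \<Rightarrow> 'v \<Rightarrow> real \<Rightarrow> real" where
  "mild q u0 u x t = exp (- vertex_degree x * t) *
     (u0 x + integral {0..t} (\<lambda>s. exp (vertex_degree x * s) * source q u x s))"

lemma vertex_degree_nonneg: "0 \<le> vertex_degree x"
  unfolding vertex_degree_def using measure_pos[of x]
  by (intro mult_nonneg_nonneg sum_nonneg) (auto intro: less_imp_le weight_pos)

lemma vertex_degree_bounded:
  assumes "D_mu adj w \<mu> < \<infinity>"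
  obtains D where "0 \<le> D" "\<And>x. vertex_degree x \<le> D"
proof -
  have le: "ereal (vertex_degree x) \<le> D_mu adj w \<mu>" for x
    unfolding D_mu_def vertex_degree_def by (rule SUP_upper) simp
  obtain D where D: "D_mu adj w \<mu> = ereal D"
    using assms le[of undefined] by (cases "D_mu adj w \<mu>") auto
  then have "vertex_degree x \<le> D" for x using le[of x] by simp
  then show ?thesis
    using that vertex_degree_nonneg order_trans by blast
qed

lemma laplacian_eq:
  "laplacian adj w \<mu> f x = 1 / \<mu> x * (\<Sum>y | adj x y. w x y * f y) - vertex_degree x * f x"
  by (simp add: laplacian_def vertex_degree_def right_diff_distrib sum_subtractf
      sum_distrib_right mult.assoc)

lemma neighbour_average_mono:
  assumes "\<And>y. f y \<le> g y"
  shows "1 / \<mu> x * (\<Sum>y | adj x y. w x y * f y) \<le> 1 / \<mu> x * (\<Sum>y | adj x y. w x y * g y)"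
  using assms measure_pos[of x]
  by (intro mult_left_mono sum_mono) (auto intro: less_imp_le weight_pos)

lemma neighbour_average_const:
  "1 / \<mu> x * (\<Sum>y | adj x y. w x y * c) = vertex_degree x * c"
  by (simp add: vertex_degree_def sum_distrib_right)

lemma source_mono:
  assumes "0 \<le> q" "\<And>y. 1 \<le> u y s" "\<And>y. u y s \<le> v y s"
  shows "source q u x s \<le> source q v x s"
  unfolding source_def using assms by (intro add_mono neighbour_average_mono reaction_mono) auto

lemma source_space_constant:
  "source q (\<lambda>_. g) x s = reaction q (g s) + vertex_degree x * g s"
  unfolding source_def neighbour_average_const by simp

lemma continuous_on_source:
  assumes "0 < q" "\<And>y. continuous_on S (u y)" "\<And>s. s \<in> S \<Longrightarrow> 0 < u x s"
  shows "continuous_on S (\<lambda>s. source q u x s)"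
  unfolding source_def using assms by (intro continuous_intros continuous_on_reaction) auto

text \<open>Edge weights and exponentials are positive and the reaction increases above 1, so the
  integrands are ordered. Continuity in time supplies integrability.\<close>

lemma mild_mono:
  assumes q: "1 < q" and t: "0 \<le> t"
    and u: "\<And>y. continuous_on {0..t} (u y)" and v: "\<And>y. continuous_on {0..t} (v y)"
    and le: "\<And>y s. s \<in> {0..t} \<Longrightarrow> 1 \<le> u y s" "\<And>y s. s \<in> {0..t} \<Longrightarrow> u y s \<le> v y s"
    and u0: "u0 x \<le> v0 x"
  shows "mild q u0 u x t \<le> mild q v0 v x t"
proof -
  have "0 < u y s" "0 < v y s" if "s \<in> {0..t}" for y s
    using le[OF that, of y] by linarith+
  then have "integral {0..t} (\<lambda>s. exp (vertex_degree x * s) * source q u x s)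
      \<le> integral {0..t} (\<lambda>s. exp (vertex_degree x * s) * source q v x s)"
    using q u v le
    by (intro integral_le integrable_continuous_real continuous_intros continuous_on_source
        mult_left_mono source_mono) auto
  then show ?thesis
    unfolding mild_def using u0 by (intro mult_left_mono) auto
qed

text \<open>For a function constant in space the source is \<open>g' + vertex_degree x * g\<close>,
  which is the integrand of \<open>duhamel\<close>. Hence the profile is a fixed point.\<close>

lemma mild_space_constant:
  assumes "0 \<le> t"
    and "\<And>s. s \<in> {0..t} \<Longrightarrow> (g has_real_derivative reaction q (g s)) (at s)"
  shows "mild q (\<lambda>_. g 0) (\<lambda>_. g) x t = g t"
proof -
  have "((\<lambda>s. exp (vertex_degree x * s) * source q (\<lambda>_. g) x s) has_integral
      exp (vertex_degree x * t) * g t - g 0) {0..t}"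
    using duhamel[of t g "\<lambda>s. reaction q (g s)" "vertex_degree x"] assms
    by (simp add: source_space_constant has_field_derivative_at_within)
  then show ?thesis
    by (simp add: mild_def integral_unique exp_minus)
qed

text \<open>A positive constant is a subsolution because the reaction is nonnegative;
  \<open>duhamel\<close> without the reaction would reproduce the constant. This starts the monotone
  iteration.\<close>

lemma const_le_mild:
  assumes "1 < q" "0 \<le> t" "0 < a" "a \<le> u0 x"
  shows "a \<le> mild q u0 (\<lambda>_ _. a) x t"
proof -
  let ?d = "vertex_degree x"
  have d: "((\<lambda>s. exp (?d * s) * (0 + ?d * a)) has_integral exp (?d * t) * a - a) {0..t}"
    using duhamel[of t "\<lambda>_. a" "\<lambda>_. 0" ?d] assms by auto
  have "exp (?d * t) * a - a \<le> integral {0..t} (\<lambda>s. exp (?d * s) * source q (\<lambda>_ _. a) x s)"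
    unfolding integral_unique[OF d, symmetric]
    using d assms reaction_nonneg[of a q] unfolding source_space_constant
    by (intro integral_le) (auto intro!: integrable_continuous_real continuous_intros mult_left_mono)
  then have "exp (- ?d * t) * (exp (?d * t) * a) \<le> mild q u0 (\<lambda>_ _. a) x t"
    unfolding mild_def using assms by (intro mult_left_mono) auto
  then show ?thesis by (simp flip: mult.assoc exp_add)
qed

lemma continuous_on_mild:
  assumes "\<And>b. 0 \<le> b \<Longrightarrow> b < T \<Longrightarrow> (\<lambda>s. exp (vertex_degree x * s) * source q u x s) integrable_on {0..b}"
  shows "continuous_on {0..<T} (mild q u0 u x)"
  unfolding mild_def[abs_def]
  by (intro continuous_intros continuous_on_indefinite_integral_Ico assms)

lemma mild_has_derivative:
  assumes "0 < t" "t < T" "continuous_on {0..<T} (source q u x)"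
  shows "(mild q u0 u x has_real_derivative
    source q u x t - vertex_degree x * mild q u0 u x t) (at t)"
proof -
  let ?d = "vertex_degree x"
  define b where "b = (t + T) / 2"
  have b: "t < b" "b < T" using assms by (auto simp: b_def)
  have "continuous_on {0..b} (\<lambda>s. exp (?d * s) * source q u x s)"
    using assms b by (intro continuous_intros continuous_on_subset[OF assms(3)]) auto
  then have "((\<lambda>t. integral {0..t} (\<lambda>s. exp (?d * s) * source q u x s)) has_real_derivative
      exp (?d * t) * source q u x t) (at t within {0..b})"
    using assms b by (intro integral_has_real_derivative) auto
  then have *: "((\<lambda>t. integral {0..t} (\<lambda>s. exp (?d * s) * source q u x s)) has_real_derivative
      exp (?d * t) * source q u x t) (at t)"
    using assms b by (simp add: at_within_Icc_at)
  have "(mild q u0 u x has_real_derivative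
      exp (- ?d * t) * (- ?d) * (u0 x + integral {0..t} (\<lambda>s. exp (?d * s) * source q u x s))
      + exp (?d * t) * source q u x t * exp (- ?d * t)) (at t)"
    unfolding mild_def[abs_def]
    by (rule derivative_eq_intros * refl | simp)+
  moreover have "exp (- ?d * t) * (- ?d) * (u0 x + integral {0..t} (\<lambda>s. exp (?d * s) * source q u x s))
      + exp (?d * t) * source q u x t * exp (- ?d * t) = source q u x t - ?d * mild q u0 u x t"
    by (simp add: mild_def exp_minus)
  ultimately show ?thesis by simp
qed

section \<open>Existence up to the blow-up time of the profile\<close>

text \<open>The iterates of \<open>mild\<close> starting from \<open>a\<close> increase and stay
  below the profile. Dominated convergence makes their limit a fixed point, and the integral form
  then yields first continuity and next differentiability in time.\<close>

lemma exists_solution: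
  assumes q: "1 < q" and A: "0 < A" and a: "1 < a"
    and u0: "\<And>x. a \<le> u0 x" "\<And>x. u0 x \<le> exp A"
  shows "\<exists>u. positive_solution adj w \<mu> q u0 (A powr (1 - q) / (q - 1)) u"
proof -
  define T where "T = A powr (1 - q) / (q - 1)"
  have tT: "(q - 1) * t < A powr (1 - q)" if "t < T" for t
    using that q by (simp add: T_def field_simps)
  let ?z = "profile q A"
  have z_deriv: "(?z has_real_derivative reaction q (?z t)) (at t)" if "t < T" for t
    using profile_has_derivative[OF q tT[OF that]] .
  have z_cont: "continuous_on {0..t} ?z" if "t < T" for t
    using that
    by (intro DERIV_continuous_on[of _ ?z "\<lambda>t. reaction q (?z t)"]
        has_field_derivative_at_within[OF z_deriv]) auto
  have az: "a \<le> ?z t" if "0 \<le> t" "t < T" for t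
    using profile_mono[OF q that(1) tT[OF that(2)]] profile_0[OF q A] u0[of undefined] by simp
  have z_mild: "mild q (\<lambda>_. exp A) (\<lambda>_. ?z) x t = ?z t" if "0 \<le> t" "t < T" for x t
    using mild_space_constant[of t ?z q x] that z_deriv profile_0[OF q A] by auto
  define U where "U n = (mild q u0 ^^ n) (\<lambda>_ _. a)" for n
  have U_0: "U 0 = (\<lambda>_ _. a)" and U_Suc: "U (Suc n) = mild q u0 (U n)" for n
    by (simp_all add: U_def)
  \<comment> \<open>The claims need each other: the lower bound makes the source continuous and the
    operator monotone, while the upper bound will keep the limit finite.\<close>
  have U: "(\<forall>x. continuous_on {0..<T} (U n x)) \<and>
      (\<forall>x. \<forall>t\<in>{0..<T}. a \<le> U n x t \<and> U n x t \<le> U (Suc n) x t \<and> U n x t \<le> ?z t)" for n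
  proof (induction n)
    case 0
    show ?case
      using const_le_mild[OF q, of _ a u0] a u0 az by (auto simp: U_0 U_Suc)
  next
    case (Suc n)
    note IH = Suc.IH[unfolded U_Suc]
    have cont: "continuous_on {0..<T} (U (Suc n) x)" for x
      unfolding U_Suc
    proof (intro continuous_on_mild integrable_continuous_real continuous_intros continuous_on_source)
      fix b s y assume b: "0 \<le> b" "b < T"
      show "continuous_on {0..b} (U n y)"
        using IH b by (auto intro: continuous_on_subset)
      show "0 < U n x s" if "s \<in> {0..b}"
      proof -
        have "a \<le> U n x s" using IH b that by auto
        then show ?thesis using a by simp
      qed
    qed (use q in auto)
    have sub: "continuous_on {0..t} (U n x)" "continuous_on {0..t} (U (Suc n) x)"
      if "t < T" for x t
      using that IH by (auto intro: continuous_on_subset continuous_on_subset[OF cont])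
    have 1: "1 \<le> U n x t" if "t \<in> {0..<T}" for x t
      using IH that a by (meson less_imp_le order_trans)
    have "U (Suc n) x t \<le> U (Suc (Suc n)) x t" if "t \<in> {0..<T}" for x t
      unfolding U_Suc[of n] U_Suc[of "Suc n"]
      using that IH q 1 sub[of t] unfolding U_Suc by (intro mild_mono) auto
    moreover have "U (Suc n) x t \<le> ?z t" if "t \<in> {0..<T}" for x t
    proof -
      have "U (Suc n) x t \<le> mild q (\<lambda>_. exp A) (\<lambda>_. ?z) x t"
        unfolding U_Suc
        using that IH q 1 sub[of t] u0 z_cont[of t] by (intro mild_mono) auto
      then show ?thesis using z_mild that by simp
    qed
    moreover have "a \<le> U (Suc n) x t" if "t \<in> {0..<T}" for x t
      using IH that order_trans unfolding U_Suc by blast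
    ultimately show ?case using cont by blast
  qed
  have U_ge: "a \<le> U n x t" and U_le: "U n x t \<le> ?z t" and U_mono: "U n x t \<le> U (Suc n) x t"
    if "0 \<le> t" "t < T" for n x t
    using U[of n] that by auto
  have U_cont: "continuous_on S (U n x)" if "S \<subseteq> {0..<T}" for n x S
    using U[of n] that by (auto intro: continuous_on_subset)
  define u where "u x t = lim (\<lambda>n. U n x t)" for x t
  have u_lim: "(\<lambda>n. U n x t) \<longlonglongrightarrow> u x t" if "0 \<le> t" "t < T" for x t
    unfolding u_def
    using incseq_convergent[of "\<lambda>n. U n x t" "?z t"] U_mono U_le that
    by (metis convergentI convergent_LIMSEQ_iff incseq_SucI)
  have u_ge: "a \<le> u x t" and u_le: "u x t \<le> ?z t" if "0 \<le> t" "t < T" for x t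
    using u_lim[OF that] U_ge[OF that] U_le[OF that]
    by (blast intro: LIMSEQ_le_const LIMSEQ_le_const2)+
  have source_lim: "(\<lambda>n. source q (U n) x t) \<longlonglongrightarrow> source q u x t" if "0 \<le> t" "t < T" for x t
  proof -
    \<comment> \<open>The strict inequality keeps the logarithm away from 0, so that
      \<open>powr\<close> passes to the limit.\<close>
    have "u x t > 1" using u_ge[OF that, of x] a by simp
    then show ?thesis
      unfolding source_def reaction_def using u_lim[OF that] by (intro tendsto_intros) auto
  qed
  have dom: "(\<lambda>s. exp (vertex_degree x * s) * source q u x s) integrable_on {0..t}"
    "(\<lambda>n. integral {0..t} (\<lambda>s. exp (vertex_degree x * s) * source q (U n) x s))
      \<longlonglongrightarrow> integral {0..t} (\<lambda>s. exp (vertex_degree x * s) * source q u x s)"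
    if t: "0 \<le> t" "t < T" for x t
  proof -
    let ?h = "\<lambda>s. exp (vertex_degree x * s) * source q (\<lambda>_. ?z) x s"
    have pos: "0 < ?z s" "0 < U n x s" if "0 \<le> s" "s \<le> t" for s n x
      using U_ge[of s n x] az[of s] that t a by linarith+
    have int: "(\<lambda>s. exp (vertex_degree x * s) * source q (U n) x s) integrable_on {0..t}" for n
      using q t pos
      by (intro integrable_continuous_real continuous_intros continuous_on_source U_cont) auto
    have h: "?h integrable_on {0..t}"
      using q t pos
      by (intro integrable_continuous_real continuous_intros continuous_on_source z_cont) auto
    \<comment> \<open>The source of the profile dominates, and it is integrable on
      \<open>[0, t]\<close> since \<open>t < T\<close>. The nonnegative source of the constant 1
      lies below every iterate's source, which disposes of the norm.\<close>
    have bd: "norm (exp (vertex_degree x * s) * source q (U n) x s) \<le> ?h s" if s: "s \<in> {0..t}" for n s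
    proof -
      have "1 \<le> U n y s" for y using U_ge[of s n y] a s t by auto
      then have "source q (\<lambda>_ _. 1) x s \<le> source q (U n) x s"
        "source q (U n) x s \<le> source q (\<lambda>_. ?z) x s"
        using q s t U_le[of s n] by (auto intro!: source_mono)
      moreover have "0 \<le> source q (\<lambda>_ _. 1) x s"
        using vertex_degree_nonneg[of x] by (simp add: source_space_constant reaction_def)
      ultimately show ?thesis by (simp add: mult_left_mono)
    qed
    have "(\<lambda>n. exp (vertex_degree x * s) * source q (U n) x s)
        \<longlonglongrightarrow> exp (vertex_degree x * s) * source q u x s" if "s \<in> {0..t}" for s
      using that t by (intro tendsto_intros source_lim) auto
    from dominated_convergence[OF int h bd this]
    show "(\<lambda>s. exp (vertex_degree x * s) * source q u x s) integrable_on {0..t}"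
      "(\<lambda>n. integral {0..t} (\<lambda>s. exp (vertex_degree x * s) * source q (U n) x s))
        \<longlonglongrightarrow> integral {0..t} (\<lambda>s. exp (vertex_degree x * s) * source q u x s)" by auto
  qed
  have u_mild: "u x t = mild q u0 u x t" if t: "0 \<le> t" "t < T" for x t
  proof -
    have "(\<lambda>n. U (Suc n) x t) \<longlonglongrightarrow> mild q u0 u x t"
      unfolding U_Suc mild_def by (intro tendsto_intros dom t)
    then show ?thesis
      using LIMSEQ_unique[OF LIMSEQ_Suc[OF u_lim[OF t]]] by simp
  qed
  \<comment> \<open>A pointwise limit need not be continuous; here continuity comes from the
    integral representation, which asks only for an integrable source. The source is then continuous
    as well, so \<open>u\<close> is differentiable.\<close>
  have u_cont: "continuous_on {0..<T} (u x)" for x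
    using continuous_on_mild[of T x q u u0] dom(1) u_mild
      continuous_on_cong[of "{0..<T}" "{0..<T}" "u x" "mild q u0 u x"] by simp
  have s_cont: "continuous_on {0..<T} (source q u x)" for x
    using q u_cont u_ge[of _ x] a by (intro continuous_on_source) force+
  have u_deriv: "(u x has_real_derivative source q u x t - vertex_degree x * u x t) (at t)"
    if t: "t \<in> {0<..<T}" for x t
  proof -
    have "eventually (\<lambda>s. mild q u0 u x s = u x s) (nhds t)"
      using eventually_nhds_in_open[of "{0<..<T}" t] t
      by (auto elim!: eventually_mono simp: u_mild)
    then show ?thesis
      using mild_has_derivative[OF _ _ s_cont, of t u0 x] t u_mild[of t x]
        DERIV_cong_ev[OF refl _ refl] by auto
  qed
  have "positive_solution adj w \<mu> q u0 T u"
    unfolding positive_solution_def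
  proof (intro conjI allI ballI impI)
    fix x t assume "t \<in> {0<..<T}"
    then show "0 < u x t" using u_ge[of t x] a by auto
  next
    fix x show "continuous_on {0..<T} (u x)" by (rule u_cont)
  next
    fix x
    have "continuous_on {0<..<T} (\<lambda>t. source q u x t - vertex_degree x * u x t)"
      by (intro continuous_intros continuous_on_subset[OF s_cont] continuous_on_subset[OF u_cont]) auto
    then show "u x C1_differentiable_on {0<..<T}"
      unfolding C1_differentiable_on_def
      using u_deriv[unfolded has_real_derivative_iff_has_vector_derivative]
      by (intro exI[of _ "\<lambda>t. source q u x t - vertex_degree x * u x t"] conjI ballI) auto
  next
    fix x t assume "t \<in> {0<..<T}"
    then show "deriv (u x) t - laplacian adj w \<mu> (\<lambda>y. u y t) x = u x t * \<bar>ln (u x t)\<bar> powr q"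
      using DERIV_imp_deriv[OF u_deriv] by (simp add: laplacian_eq source_def reaction_def)
  next
    fix x
    have "0 < T" using A q by (simp add: T_def)
    then show "u x 0 = u0 x" by (simp add: u_mild mild_def)
  next
    fix T' assume T': "0 < T' \<and> T' < T"
    have "\<bar>u x t\<bar> \<le> ?z T'" if "t \<in> {0..T'}" for x t
      using u_ge[of t x] u_le[of t x] profile_mono[OF q _ tT, of t T'] T' that a by auto
    then show "bounded ((\<lambda>(x, t). u x t) ` (UNIV \<times> {0..T'}))"
      unfolding bounded_iff by (intro exI[of _ "?z T'"]) auto
  qed
  then show ?thesis unfolding T_def by blast
qed

section \<open>Comparison with the profile and the upper bound on the existence time\<close>

text \<open>On an infinite graph the infimum over the vertices need not be attained, so there is no
  vertex at which to run a minimum argument. Instead \<open>y - u\<close> is bounded, uniformly in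
  space, by the terms of an exponential series, which tend to 0.\<close>

lemma profile_le_solution:
  assumes D: "0 \<le> D" "\<And>x. vertex_degree x \<le> D"
    and q: "1 < q" and A: "0 < A"
    and sol: "positive_solution adj w \<mu> q u0 T u" and u0: "\<And>x. exp A \<le> u0 x"
    and \<tau>: "0 \<le> \<tau>" "\<tau> < T" "(q - 1) * \<tau> < A powr (1 - q)"
  shows "profile q A \<tau> \<le> u x \<tau>"
proof -
  let ?y = "profile q A"
  have in_time: "(q - 1) * t < A powr (1 - q)" if "t \<le> \<tau>" for t
    using \<tau> that q by (smt (verit) mult_left_mono)
  have u_init: "u x 0 = u0 x" for x
    using sol by (simp add: positive_solution_def)
  have u_cont: "continuous_on {0..\<tau>} (u x)" for x
    using sol \<tau> by (auto simp: positive_solution_def intro: continuous_on_subset)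
  \<comment> \<open>A solution is positive by definition only at positive times; time 0 is covered
    by the initial datum.\<close>
  have u_nonneg: "0 \<le> u x t" if "0 \<le> t" "t \<le> \<tau>" for x t
  proof (cases "t = 0")
    case True
    then show ?thesis using u0[of x] exp_gt_zero[of A] by (simp add: u_init del: exp_gt_zero)
  next
    case False
    then show ?thesis using sol that \<tau> by (auto simp: positive_solution_def less_imp_le)
  qed
  have u_deriv: "(u x has_real_derivative source q u x t - vertex_degree x * u x t) (at t)"
    if "0 < t" "t < \<tau>" for x t
  proof -
    have "u x differentiable (at t)"
      using sol that \<tau> by (force simp: positive_solution_def C1_differentiable_on_eq)
    then have "(u x has_real_derivative deriv (u x) t) (at t)"
      by (simp add: DERIV_deriv_iff_real_differentiable)
    moreover have "deriv (u x) t - laplacian adj w \<mu> (\<lambda>y. u y t) x = reaction q (u x t)"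
      using sol that \<tau> by (simp add: positive_solution_def reaction_def)
    then have "deriv (u x) t = source q u x t - vertex_degree x * u x t"
      by (simp add: laplacian_eq source_def algebra_simps)
    ultimately show ?thesis by simp
  qed
  define K where "K = ?y \<tau>"
  define L where "L = ln K powr q + q * ln K powr (q - 1)"
  have L: "0 \<le> L" using q by (simp add: L_def)
  \<comment> \<open>\<open>b 0 = K\<close> bounds \<open>y - u\<close> because \<open>u\<close> is
    nonnegative. Each \<open>b (Suc n)\<close> is the antiderivative of \<open>(D + L) * b n\<close>
    that vanishes at 0, where \<open>D\<close> accounts for the neighbours and \<open>L\<close> for
    the reaction.\<close>
  define b where "b n t = K * ((D + L) * t) ^ n / fact n" for n t
  have K: "1 < K" unfolding K_def using \<tau> by (intro profile_gt_1)
  have b_nonneg: "0 \<le> b n t" if "0 \<le> t" for n t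
    using that K D L by (simp add: b_def)
  have b_deriv: "(b (Suc n) has_real_derivative (D + L) * b n t) (at t)" for n t
    unfolding b_def[abs_def] by (rule derivative_eq_intros refl | simp)+
  have y_le: "?y t \<le> K" if "t \<le> \<tau>" for t
    unfolding K_def using profile_mono[OF q that \<tau>(3)] .
  have y_gt: "1 < ?y t" if "t \<le> \<tau>" for t
    using profile_gt_1[OF in_time[OF that]] .
  have y_deriv: "(?y has_real_derivative reaction q (?y t)) (at t)" if "t \<le> \<tau>" for t
    using profile_has_derivative[OF q in_time[OF that]] .
  have "\<forall>x. \<forall>t\<in>{0..\<tau>}. ?y t - u x t \<le> b n t" for n
  proof (induction n)
    case 0
    show ?case
    proof (intro allI ballI)
      fix x t assume "t \<in> {0..\<tau>}"
      then show "?y t - u x t \<le> b 0 t"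
        using y_le[of t] u_nonneg[of t x] by (simp add: b_def)
    qed
  next
    case (Suc n)
    show ?case
    proof (intro allI ballI)
      fix x t assume t: "t \<in> {0..\<tau>}"
      let ?d = "vertex_degree x"
      \<comment> \<open>The exponential weight cancels the diagonal term of the Laplacian in the
        derivative; the claim becomes that \<open>?g\<close> decreases from a nonpositive
        value.\<close>
      let ?g = "\<lambda>s. exp (?d * s) * (?y s - u x s - b (Suc n) s)"
      have "?g t \<le> ?g 0"
      proof (rule DERIV_nonpos_imp_decreasing_open[where f = ?g])
        show "0 \<le> t" using t by simp
        have "continuous_on {0..t} ?y"
          using t
          by (intro DERIV_continuous_on[of _ ?y "\<lambda>t. reaction q (?y t)"]
              has_field_derivative_at_within[OF y_deriv]) auto
        moreover have "continuous_on {0..t} (b (Suc n))"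
          by (rule DERIV_continuous_on[OF has_field_derivative_at_within[OF b_deriv]])
        moreover have "continuous_on {0..t} (u x)"
          using t by (intro continuous_on_subset[OF u_cont]) auto
        ultimately show "continuous_on {0..t} ?g"
          by (intro continuous_intros)
      next
        fix s assume s: "0 < s" "s < t"
        let ?e = "reaction q (?y s) - (source q u x s - ?d * u x s) - (D + L) * b n s
          + ?d * (?y s - u x s - b (Suc n) s)"
        have "(?g has_real_derivative exp (?d * s) * ?e) (at s)"
          using t s
          by (auto intro!: derivative_eq_intros y_deriv u_deriv b_deriv simp: algebra_simps)
        \<comment> \<open>Once \<open>?d * u x s\<close> cancels, the reaction contributes at most
          \<open>L * b n s\<close> and the neighbours at most \<open>D * b n s\<close>, which
          \<open>(D + L) * b n s\<close> absorbs; the remaining term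
          \<open>- ?d * b (Suc n) s\<close> is nonpositive.\<close>
        moreover have "?e \<le> 0"
        proof -
          have IH: "?y s - u z s \<le> b n s" for z using Suc.IH s t by auto
          have "reaction q (?y s) - reaction q (u x s) \<le> L * max 0 (?y s - u x s)"
            unfolding L_def using reaction_diff_le[OF q] u_nonneg y_gt[of s] y_le[of s] s t by auto
          also have "\<dots> \<le> L * b n s"
            using IH L b_nonneg[of s n] s by (intro mult_left_mono) auto
          finally have 1: "reaction q (?y s) - reaction q (u x s) \<le> L * b n s" .
          have "?d * (?y s - b n s) \<le> 1 / \<mu> x * (\<Sum>y | adj x y. w x y * u y s)"
            unfolding neighbour_average_const[symmetric]
            using IH by (intro neighbour_average_mono) (simp add: algebra_simps)
          moreover have "?d * b n s \<le> D * b n s" "0 \<le> ?d * b (Suc n) s"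
            using D b_nonneg[of s] s vertex_degree_nonneg[of x] by (auto intro: mult_right_mono)
          ultimately show ?thesis
            using 1 by (simp add: source_def algebra_simps)
        qed
        ultimately show "\<exists>y. (?g has_real_derivative y) (at s) \<and> y \<le> 0"
          by (intro exI[of _ "exp (?d * s) * ?e"]) (simp add: mult_nonneg_nonpos)
      qed
      also have "?g 0 \<le> 0"
        using u0[of x] profile_0[OF q A] by (simp add: u_init b_def)
      finally show "?y t - u x t \<le> b (Suc n) t"
        by (simp add: mult_le_0_iff)
    qed
  qed
  then have "?y \<tau> - u x \<tau> \<le> b n \<tau>" for n using \<tau> by simp
  moreover have "(\<lambda>n. b n \<tau>) \<longlonglongrightarrow> 0"
    unfolding b_def using tendsto_mult_right_zero[OF tendsto_power_over_fact, of K]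
    by (simp add: times_divide_eq_right)
  ultimately have "?y \<tau> - u x \<tau> \<le> 0" by (intro LIMSEQ_le_const) auto
  then show ?thesis by simp
qed

text \<open>A solution living past the blow-up time of the profile would be bounded up to that time,
  yet it would lie above the profile, which takes arbitrarily large values before it.\<close>

lemma existence_time_le:
  assumes D: "0 \<le> D" "\<And>x. vertex_degree x \<le> D"
    and q: "1 < q" and A: "0 < A"
    and sol: "positive_solution adj w \<mu> q u0 T u" and u0: "\<And>x. exp A \<le> u0 x"
  shows "T \<le> A powr (1 - q) / (q - 1)"
proof (rule ccontr)
  define T\<^sub>A where "T\<^sub>A = A powr (1 - q) / (q - 1)"
  assume "\<not> T \<le> A powr (1 - q) / (q - 1)"
  then have T: "T\<^sub>A < T" "0 < T\<^sub>A" using A q by (auto simp: T\<^sub>A_def)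
  then have "bounded ((\<lambda>(x, t). u x t) ` (UNIV \<times> {0..T\<^sub>A}))"
    using sol by (auto simp: positive_solution_def)
  then obtain B where "\<forall>r\<in>(\<lambda>(x, t). u x t) ` (UNIV \<times> {0..T\<^sub>A}). norm r \<le> B"
    unfolding bounded_iff by blast
  then have B: "\<bar>u x t\<bar> \<le> B" if "t \<in> {0..T\<^sub>A}" for x t
    using that by fastforce
  define B' where "B' = max B (exp A) + 1"
  have B': "B < B'" "exp A < B'" by (auto simp: B'_def)
  have "0 < B'" using B'(2) exp_gt_zero[of A] by linarith
  then have lnB: "A < ln B'" using B'(2) ln_less_cancel_iff[of "exp A" B'] by simp
  \<comment> \<open>\<open>R\<close> is the base at which the profile equals \<open>B'\<close>, and
    \<open>t\<close> below is the time at which this base is reached. \<open>B' > exp A\<close> puts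
    that time after 0, and \<open>R > 0\<close> puts it before blow-up.\<close>
  define R where "R = ln B' powr (1 - q)"
  have R: "0 < R" "R < A powr (1 - q)"
    unfolding R_def using lnB A q by (auto intro!: powr_less_mono2_neg)
  define t where "t = (A powr (1 - q) - R) / (q - 1)"
  have t: "(q - 1) * t = A powr (1 - q) - R" "0 \<le> t" "t < T\<^sub>A"
    using R q by (auto simp: t_def T\<^sub>A_def divide_strict_right_mono)
  have "profile q A t = B'"
    using q less_trans[OF A lnB] \<open>0 < B'\<close> by (simp add: profile_def t(1) R_def powr_powr)
  then have "B' \<le> u undefined t"
    using profile_le_solution[OF D q A sol u0, of t undefined] t T R by simp
  then show False
    using B[of t undefined] t B' by auto
qed

section \<open>Bounds on the lifespan and their asymptotics\<close>

lemma lifespan_le: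
  assumes "D_mu adj w \<mu> < \<infinity>" "1 < q" "0 < A" "\<And>x. exp A \<le> u0 x"
  shows "lifespan adj w \<mu> q u0 \<le> ereal (A powr (1 - q) / (q - 1))"
proof -
  obtain D where "0 \<le> D" "\<And>x. vertex_degree x \<le> D"
    using vertex_degree_bounded[OF assms(1)] by blast
  then show ?thesis
    unfolding lifespan_def using existence_time_le[of D q A u0] assms by (auto intro!: Sup_least)
qed

lemma lifespan_ge:
  assumes "1 < q" "0 < A" "1 < a" "\<And>x. a \<le> u0 x" "\<And>x. u0 x \<le> exp A"
  shows "ereal (A powr (1 - q) / (q - 1)) \<le> lifespan adj w \<mu> q u0"
  unfolding lifespan_def using exists_solution[of q A a u0] assms by (auto intro!: Sup_upper)

text \<open>Multiplied by \<open>ln (l * M) powr (q - 1)\<close>, the lower bound becomes exactly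
  \<open>1 / (q - 1)\<close>, and the upper bound acquires the factor
  \<open>(ln (l * M) / ln (l * m)) powr (q - 1)\<close>, which tends to 1.\<close>

lemma lifespan_asymptotics:
  assumes D: "D_mu adj w \<mu> < \<infinity>" and q: "1 < q"
    and m: "0 < m" "\<And>x. m \<le> \<psi> x" and M: "\<And>x. \<psi> x \<le> M"
  shows "((\<lambda>l. ereal (ln (l * M) powr (q - 1)) * lifespan adj w \<mu> q (\<lambda>x. l * \<psi> x))
    \<longlongrightarrow> ereal (1 / (q - 1))) at_top"
proof (rule tendsto_sandwich)
  have mM: "m \<le> M" using m M order_trans by blast
  \<comment> \<open>Beyond this threshold the datum exceeds 1 uniformly, so both lifespan bounds
    apply and all logarithms are positive.\<close>
  have large: "eventually (\<lambda>l. 1 < l * m \<and> 0 < l) at_top"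
    using eventually_gt_at_top[of "1 / m"] eventually_gt_at_top[of 0]
    by eventually_elim (use m in \<open>simp add: field_simps\<close>)
  have logs: "0 < ln (l * m)" "0 < ln (l * M)" "1 < l * M" if "1 < l * m" "0 < l" for l
    using that mM by (auto intro!: ln_gt_zero less_le_trans[of 1 "l * m" "l * M"])
  show "eventually (\<lambda>l. ereal (1 / (q - 1))
      \<le> ereal (ln (l * M) powr (q - 1)) * lifespan adj w \<mu> q (\<lambda>x. l * \<psi> x)) at_top"
    using large
  proof eventually_elim
    case (elim l)
    have "1 / (q - 1) = ln (l * M) powr (q - 1) * (ln (l * M) powr (1 - q) / (q - 1))"
      using logs[of l] elim by (simp flip: powr_add)
    moreover have "ereal (ln (l * M) powr (1 - q) / (q - 1)) \<le> lifespan adj w \<mu> q (\<lambda>x. l * \<psi> x)"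
      using logs[of l] elim q m M by (intro lifespan_ge[of q _ "l * m"]) auto
    ultimately show ?case
      by (simp only: times_ereal.simps(1)[symmetric]) (intro ereal_mult_left_mono, auto)
  qed
  show "eventually (\<lambda>l. ereal (ln (l * M) powr (q - 1)) * lifespan adj w \<mu> q (\<lambda>x. l * \<psi> x)
      \<le> ereal ((ln (l * M) / ln (l * m)) powr (q - 1) / (q - 1))) at_top"
    using large
  proof eventually_elim
    case (elim l)
    have "ln (l * m) powr (1 - q) = inverse (ln (l * m) powr (q - 1))"
      using powr_minus[of "ln (l * m)" "q - 1"] by simp
    moreover have "(ln (l * M) / ln (l * m)) powr (q - 1) = ln (l * M) powr (q - 1) / ln (l * m) powr (q - 1)"
      by (rule powr_divide)
    ultimately have "(ln (l * M) / ln (l * m)) powr (q - 1) / (q - 1)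
        = ln (l * M) powr (q - 1) * (ln (l * m) powr (1 - q) / (q - 1))"
      by (simp add: divide_inverse)
    moreover have "lifespan adj w \<mu> q (\<lambda>x. l * \<psi> x) \<le> ereal (ln (l * m) powr (1 - q) / (q - 1))"
      using logs[of l] elim q m D by (intro lifespan_le) auto
    ultimately show ?case
      by (simp only: times_ereal.simps(1)[symmetric]) (intro ereal_mult_left_mono, auto)
  qed
  have "((\<lambda>l. ln (l * M) / ln (l * m)) \<longlongrightarrow> 1) at_top"
    using m(1) mM by real_asymp
  then have "((\<lambda>l. (ln (l * M) / ln (l * m)) powr (q - 1) / (q - 1)) \<longlongrightarrow> 1 powr (q - 1) / (q - 1)) at_top"
    using q by (intro tendsto_intros) auto
  then show "((\<lambda>l. ereal ((ln (l * M) / ln (l * m)) powr (q - 1) / (q - 1)))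
      \<longlongrightarrow> ereal (1 / (q - 1))) at_top"
    by simp
qed auto

end

theorem theorem1p1:
  fixes adj :: "'v \<Rightarrow> 'v \<Rightarrow> bool"
    and w :: "'v \<Rightarrow> 'v \<Rightarrow> real"
    and \<mu> :: "'v \<Rightarrow> real"
    and q :: real
  assumes "weighted_graph adj w \<mu>"
    and "D_mu adj w \<mu> < \<infinity>"
    and "1 < q"
  shows "\<exists>C>0. \<forall>\<psi> :: 'v \<Rightarrow> real.
    (\<forall>x. 0 \<le> \<psi> x) \<and> bounded (range \<psi>) \<and> (\<exists>x. \<psi> x \<noteq> 0) \<and> 0 < (INF x. \<psi> x) \<longrightarrow>
      (\<forall>L l T u \<Omega> \<phi>.
         0 < L \<and> max C (exp (1 - q)) \<le> L * (INF x. \<psi> x) \<and> L < l \<and>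
         0 < T \<and> positive_solution adj w \<mu> q (\<lambda>x. l * \<psi> x) T u \<and>
         \<Omega> \<noteq> {} \<and> finite \<Omega> \<and> connected_subset adj \<Omega> \<and>
         normalized_first_eigenfunction adj w \<mu> \<Omega> \<phi> \<and>
         1 \<le> (\<Sum>x\<in>\<Omega>. \<mu> x * u x 0 * \<phi> x)
         \<longrightarrow> lifespan adj w \<mu> q (\<lambda>x. l * \<psi> x) < \<infinity>) \<and>
      ((\<lambda>l :: real. ereal (ln (l * sup_norm \<psi>) powr (q - 1)) * lifespan adj w \<mu> q (\<lambda>x. l * \<psi> x))
         \<longlongrightarrow> ereal (1 / (q - 1))) at_top"
proof (rule exI[of _ 1], intro conjI allI impI)
  show "(0::real) < 1" by simp
  interpret weighted_graph adj w \<mu> by (fact assms)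
  fix \<psi> :: "'v \<Rightarrow> real"
  assume \<psi>: "(\<forall>x. 0 \<le> \<psi> x) \<and> bounded (range \<psi>) \<and> (\<exists>x. \<psi> x \<noteq> 0) \<and> 0 < (INF x. \<psi> x)"
  define m where "m = (INF x. \<psi> x)"
  have m: "0 < m" "m \<le> \<psi> x" for x
    using \<psi> by (auto simp: m_def intro!: cINF_lower bounded_imp_bdd_below)
  have "\<psi> x \<le> sup_norm \<psi>" for x
  proof -
    have "(\<lambda>x. \<bar>\<psi> x\<bar>) = \<psi>" using \<psi> by auto
    then show ?thesis
      using \<psi> unfolding sup_norm_def by (auto intro!: cSUP_upper bounded_imp_bdd_above)
  qed
  then show "((\<lambda>l :: real. ereal (ln (l * sup_norm \<psi>) powr (q - 1)) * lifespan adj w \<mu> q (\<lambda>x. l * \<psi> x))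
      \<longlongrightarrow> ereal (1 / (q - 1))) at_top"
    using lifespan_asymptotics assms m by blast
  fix L l T u \<Omega> \<phi>
  assume *: "0 < L \<and> max 1 (exp (1 - q)) \<le> L * (INF x. \<psi> x) \<and> L < l \<and>
      0 < T \<and> positive_solution adj w \<mu> q (\<lambda>x. l * \<psi> x) T u \<and>
      \<Omega> \<noteq> {} \<and> finite \<Omega> \<and> connected_subset adj \<Omega> \<and>
      normalized_first_eigenfunction adj w \<mu> \<Omega> \<phi> \<and>
      1 \<le> (\<Sum>x\<in>\<Omega>. \<mu> x * u x 0 * \<phi> x)"
  then have "1 \<le> L * m" "L < l" "0 < l" by (auto simp: m_def)
  \<comment> \<open>Strictness matters: \<open>L * m \<ge> 1\<close> alone would allow
    \<open>ln (l * m) = 0\<close>, whereas the bound on the lifespan needs a positive exponent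
    \<open>A\<close>.\<close>
  moreover have "L * m < l * m" using * m by (auto intro: mult_strict_right_mono)
  ultimately have l: "1 < l * m" "0 < l" by auto
  then have "lifespan adj w \<mu> q (\<lambda>x. l * \<psi> x) \<le> ereal (ln (l * m) powr (1 - q) / (q - 1))"
    using assms m by (intro lifespan_le) auto
  then show "lifespan adj w \<mu> q (\<lambda>x. l * \<psi> x) < \<infinity>"
    using le_less_trans less_ereal.simps(4) by blast
qed

end
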